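(* Let $G=(V_G,E_G)$ be a hypergraph with $V_G=\{0,1,\dots,p\}\subset\mathbb{N}_0$ and $E_G$ a finite (multi)collection of nonempty subsets of $V_G$. Write each edge as the tuple of its nodes in strictly ascending order, order the edges in descending lexicographic order (where a proper prefix of a tuple is lexicographically smaller than the tuple), and let $T$ be the concatenation of these tuples in that order, a string of length $M_G=\sum_{e\in E_G}|e|$ over the alphabet $V_G$. Then for every position $j$ with $0\le j$ and $j+1\le M_G-1$: if $T[j+1]\le T[j]$, then $T[j+1..]<T[j..]$ in lexicographic order.
   Context: For a string $T=T[0]T[1]\cdots T[|T|-1]$, $T[i..]$ denotes the suffix $T[i]T[i+1]\cdots T[|T|-1]$. Strings over $\mathbb{N}_0$ are compared lexicographically, with a proper prefix of a string being smaller than that string. The collection $E_G$ may contain the same edge several times; each edge contains each of its nodes exactly once. *)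

theory Defs
  imports Main "HOL-Library.Multiset" "HOL-Library.List_Lexorder"
begin

text \<open>
  The order on lists is the one of List_Lexorder: lexicographic, with a proper prefix smaller
  than the list. A multiset is finite by construction, so \<open>nat set multiset\<close> is the type of finite
  collections of edges with repetitions.
\<close>

definition hypergraph :: "nat set \<Rightarrow> nat set multiset \<Rightarrow> bool" where
  "hypergraph V E \<longleftrightarrow> (\<forall>e\<in>#E. e \<noteq> {} \<and> e \<subseteq> V)"

definition total_size :: "nat set multiset \<Rightarrow> nat" where
  "total_size E = (\<Sum>e\<in>#E. card e)"

definition edge_tuple :: "nat set \<Rightarrow> nat list" where
  "edge_tuple e = sorted_list_of_set e"

definition edge_list :: "nat set multiset \<Rightarrow> nat list list" where
  "edge_list E = rev (sorted_list_of_multiset (image_mset edge_tuple E))"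

definition hypergraph_string :: "nat set multiset \<Rightarrow> nat list" where
  "hypergraph_string E = concat (edge_list E)"

abbreviation suffix_from :: "'a list \<Rightarrow> nat \<Rightarrow> 'a list" where
  "suffix_from T i \<equiv> drop i T"

lemma edge_tuple_strictly_ascending: "sorted_wrt (<) (edge_tuple e)"
  by (simp add: edge_tuple_def)

lemma set_edge_tuple: "finite e \<Longrightarrow> set (edge_tuple e) = e"
  by (simp add: edge_tuple_def)

lemma mset_edge_list: "mset (edge_list E) = image_mset edge_tuple E"
  by (simp add: edge_list_def)

lemma edge_list_descending: "sorted_wrt (\<ge>) (edge_list E)"
  by (simp add: edge_list_def sorted_wrt_rev)

lemma length_hypergraph_string: "length (hypergraph_string E) = total_size E"
proof -
  have "length (hypergraph_string E) = sum_mset (image_mset length (mset (edge_list E)))"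
    by (simp add: hypergraph_string_def length_concat sum_mset_sum_list flip: mset_map)
  then show ?thesis
    by (simp add: mset_edge_list total_size_def edge_tuple_def image_mset.compositionality comp_def)
qed

lemma set_hypergraph_string:
  assumes "finite V" and "hypergraph V E"
  shows "set (hypergraph_string E) \<subseteq> V"
proof -
  have "set (edge_list E) = edge_tuple ` set_mset E"
    by (metis mset_edge_list set_image_mset set_mset_mset)
  moreover have "set (edge_tuple e) \<subseteq> V" if "e \<in># E" for e
    using that assms by (metis hypergraph_def finite_subset set_edge_tuple)
  ultimately show ?thesis
    by (auto simp: hypergraph_string_def)
qed

end

theory Submission
  imports Defs
begin

text \<open>
  Inside an edge \<open>T\<close> strictly ascends, so \<open>T ! (j + 1) \<le> T ! j\<close> forces \<open>j\<close> to be the last position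
  of an edge \<open>x\<close>. If the two letters are equal, say to \<open>a\<close>, then the descending order of the edges
  forces \<open>x = [a]\<close>, and all later edges are at most \<open>[a]\<close>: the remaining string is
  \<open>a\<^sup>k\<close> followed by the end of the string or by a letter below \<open>a\<close>, so prepending
  \<open>a\<close> increases it.
\<close>

text \<open>A nonempty \<open>x \<le> [a]\<close> either starts with a letter below
  \<open>a\<close>, which decides the comparison at once, or is \<open>[a]\<close>; then one
  \<open>a\<close> cancels on both sides and the claim for the shorter list remains.\<close>

lemma concat_less_Cons_concat:
  fixes a :: "'a::linorder"
  assumes "\<And>x. x \<in> set xs \<Longrightarrow> x \<noteq> [] \<and> x \<le> [a]"
  shows "concat xs < a # concat xs"
  using assms
proof (induction xs)
  case (Cons x xs)
  then obtain b r where x: "x = b # r" and "b # r \<le> [a]"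
    by (metis list.exhaust list.set_intros(1))
  then consider "b < a" | "b = a" "r = []"
    by auto
  then show ?case
    using Cons x by cases auto
qed simp

lemma suffix_less_of_concat_descending:
  fixes xs :: "'a::linorder list list"
  assumes "sorted_wrt (\<ge>) xs"
    and "\<And>x. x \<in> set xs \<Longrightarrow> x \<noteq> [] \<and> sorted_wrt (<) x"
    and "Suc j < length (concat xs)"
    and "concat xs ! Suc j \<le> concat xs ! j"
  shows "drop (Suc j) (concat xs) < drop j (concat xs)"
  using assms
proof (induction xs arbitrary: j)
  case (Cons x xs)
  have x: "x \<noteq> []" "sorted_wrt (<) x" and le: "\<And>y. y \<in> set xs \<Longrightarrow> y \<le> x"
    using Cons.prems by auto
  consider "Suc j < length x" | "Suc j = length x" | "length x \<le> j"
    by linarith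
  then show ?case
  proof cases
    case 1
    then have "x ! j < x ! Suc j"
      using x(2) by (simp add: sorted_wrt_nth_less)
    then show ?thesis
      using 1 Cons.prems(4) by (simp add: nth_append)
  next
    case 2
    then obtain zs a where za: "x = zs @ [a]" "j = length zs"
      using x(1) by (metis length_append_singleton nat.inject rev_exhaust)
    have "concat xs \<noteq> []"
      using Cons.prems(3) 2 by auto
    then obtain y ys where xs: "xs = y # ys"
      by (cases xs) auto
    then obtain b r where y: "y = b # r"
      using Cons.prems(2)[of y] by (cases y) auto
    have "b \<le> a"
      using Cons.prems(4) za xs y by (simp add: nth_append)
    moreover have "concat xs < a # concat xs" if "b = a"
    proof -
      \<comment> \<open>Otherwise the ascending \<open>x\<close> would start with a letter
        \<open>c < a\<close>, and the next edge \<open>y = a # r\<close> would exceed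
        \<open>x\<close>.\<close>
      have "zs = []"
      proof (cases zs)
        case (Cons c cs)
        then have "c < a"
          using x(2) za by simp
        moreover have "a # r \<le> c # cs @ [a]"
          using le[of y] xs y that za Cons by simp
        ultimately show ?thesis
          by auto
      qed simp
      then show ?thesis
        using le za Cons.prems(2) by (intro concat_less_Cons_concat) auto
    qed
    ultimately have "concat xs < a # concat xs"
      using xs y by fastforce
    then show ?thesis
      using za by simp
  next
    case 3
    then obtain k where "j = length x + k"
      using le_Suc_ex by blast
    then show ?thesis
      using Cons.IH[of k] Cons.prems by (simp add: nth_append)
  qed
qed simp

theorem theorem1:
  fixes p j :: nat and V :: "nat set" and E :: "nat set multiset" and T :: "nat list"
  assumes "V = {0..p}"
    and "hypergraph V E"
    and "T = hypergraph_string E"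
    and "j + 1 < total_size E"
    and "T ! (j + 1) \<le> T ! j"
  shows "suffix_from T (j + 1) < suffix_from T j"
proof -
  have "x \<noteq> [] \<and> sorted_wrt (<) x" if "x \<in> set (edge_list E)" for x
  proof -
    obtain e where e: "e \<in># E" "x = edge_tuple e"
      using \<open>x \<in> set (edge_list E)\<close> by (metis imageE mset_edge_list set_image_mset set_mset_mset)
    \<comment> \<open>Finiteness matters: \<open>sorted_list_of_set\<close> is \<open>[]\<close> on
      infinite sets, so only for finite \<open>e\<close> does \<open>e \<noteq> {}\<close> give a
      nonempty tuple.\<close>
    then have "finite e" "e \<noteq> {}"
      using assms(1,2) by (auto simp: hypergraph_def intro: finite_subset)
    then show ?thesis
      using e edge_tuple_strictly_ascending set_edge_tuple by fastforce
  qed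
  then show ?thesis
    using suffix_less_of_concat_descending[OF edge_list_descending, of E j] assms(3-5)
    by (simp add: hypergraph_string_def flip: length_hypergraph_string)
qed

end
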